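(* Let $\mathcal{G}$ be a connected noncompact metric graph with finitely many edges and with non-empty compact core $\mathcal{K}$. For $p>6$ and $\mu>0$, let $u\in H^1_\mu(\mathcal{G})$ be a critical point of $$E(u,\mathcal{G})=\frac12\int_{\mathcal{G}}|u'|^2\,dx-\frac1p\int_{\mathcal{K}}|u|^p\,dx$$ constrained to $H^1_\mu(\mathcal{G})=\{w\in H^1(\mathcal{G}):\int_{\mathcal{G}}|w|^2\,dx=\mu\}$, with associated Lagrange multiplier $\lambda$, and suppose that $u>0$ and $\lambda>0$. If $\bar x\in\mathcal{G}$ is a local maximum point of $u$, then $\bar x\in\mathcal{K}$. Furthermore, on any half-line $\ell_i\simeq[0,+\infty)$ of $\mathcal{G}$ one has $u(x)=c_ie^{-\sqrt{\lambda}x}$ for some $c_i>0$.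
   Context: A metric graph $\mathcal{G}$ consists of edges and vertices; each bounded edge $\mathrm{e}$ is identified with $I_{\mathrm{e}}=[0,\ell_{\mathrm{e}}]$ and each unbounded edge with a half-line $I_{\mathrm{e}}=[0,+\infty)$. Noncompact (with finitely many edges) means that there is at least one half-line. The compact core $\mathcal{K}$ is the metric subgraph consisting of all bounded edges of $\mathcal{G}$. The space $H^1(\mathcal{G})$ is the set of continuous $u:\mathcal{G}\to\mathbb{R}$ whose restriction $u_{\mathrm{e}}$ to each edge lies in $H^1(I_{\mathrm{e}})$, with norm $\|u\|_{H^1(\mathcal{G})}^2=\sum_{\mathrm{e}}(\|u_{\mathrm{e}}'\|_{L^2}^2+\|u_{\mathrm{e}}\|_{L^2}^2)$. If $u$ is a constrained critical point, the Lagrange multiplier is the $\lambda\in\mathbb{R}$ such that $-u''+\lambda u=\kappa(x)|u|^{p-2}u$ on every edge of $\mathcal{G}$, where $\kappa$ is the characteristic function of $\mathcal{K}$, together with the Kirchhoff condition $\sum_{\mathrm{e}\succ\mathrm{v}}u_{\mathrm{e}}'(\mathrm{v})=0$ at every vertex ($\mathrm{e}\succ\mathrm{v}$ means $\mathrm{e}$ is incident at $\mathrm{v}$; $u_{\mathrm{e}}'(\mathrm{v})$ is $u_{\mathrm{e}}'(0)$ or $-u_{\mathrm{e}}'(\ell_{\mathrm{e}})$ according to whether $\mathrm{v}$ corresponds to $0$ or $\ell_{\mathrm{e}}$). *)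

theory Defs
  imports "HOL-Analysis.Analysis"
begin

section \<open>Metric graphs\<close>

text \<open>
  Loops and multiple edges are allowed. The bounded edge \<open>e\<close> is identified with
  \<open>[0, len G e]\<close>, where \<open>0\<close> corresponds to \<open>src G e\<close> and \<open>len G e\<close> to \<open>tgt G e\<close>;
  the half-line \<open>e\<close> is identified with \<open>[0, \<infinity>)\<close>, where \<open>0\<close> corresponds to \<open>src G e\<close>.
  The values of \<open>len\<close> and \<open>tgt\<close> on half-lines are irrelevant.
\<close>

record ('v, 'e) metric_graph =
  verts :: "'v set"
  bounded_edges :: "'e set"
  half_lines :: "'e set"
  src :: "'e \<Rightarrow> 'v"
  tgt :: "'e \<Rightarrow> 'v"
  len :: "'e \<Rightarrow> real"

definition edges :: "('v, 'e) metric_graph \<Rightarrow> 'e set" where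
  "edges G = bounded_edges G \<union> half_lines G"

locale finite_metric_graph =
  fixes G :: "('v, 'e) metric_graph"
  assumes finite_edges: "finite (edges G)"
    and bounded_edges_half_lines_disjoint: "bounded_edges G \<inter> half_lines G = {}"
    and src_in_verts: "e \<in> edges G \<Longrightarrow> src G e \<in> verts G"
    and tgt_in_verts: "e \<in> bounded_edges G \<Longrightarrow> tgt G e \<in> verts G"
    and len_pos: "e \<in> bounded_edges G \<Longrightarrow> 0 < len G e"

definition edge_interval :: "('v, 'e) metric_graph \<Rightarrow> 'e \<Rightarrow> real set" where
  "edge_interval G e = (if e \<in> bounded_edges G then {0..len G e} else {0..})"

text \<open>
  The underlying space is the disjoint union of the intervals with endpoints glued at the
  vertices. \<open>graph_point G e x\<close> is the point with coordinate \<open>x\<close> on the edge \<open>e\<close>, i.e. the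
  quotient map restricted to \<open>e\<close>.
\<close>

datatype ('v, 'e) graph_point = Vertex 'v | Inner 'e real

definition graph_point :: "('v, 'e) metric_graph \<Rightarrow> 'e \<Rightarrow> real \<Rightarrow> ('v, 'e) graph_point" where
  "graph_point G e x =
     (if x = 0 then Vertex (src G e)
      else if e \<in> bounded_edges G \<and> x = len G e then Vertex (tgt G e)
      else Inner e x)"

definition points :: "('v, 'e) metric_graph \<Rightarrow> ('v, 'e) graph_point set" where
  "points G = Vertex ` verts G \<union> (\<Union>e\<in>edges G. graph_point G e ` edge_interval G e)"

definition compact_core :: "('v, 'e) metric_graph \<Rightarrow> ('v, 'e) graph_point set" where
  "compact_core G = (\<Union>e\<in>bounded_edges G. graph_point G e ` edge_interval G e)"

text \<open>
  The quotient topology. As there are finitely many edges, it coincides with the topology of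
  the shortest-path metric.
\<close>

definition graph_topology :: "('v, 'e) metric_graph \<Rightarrow> ('v, 'e) graph_point topology" where
  "graph_topology G = topology (\<lambda>U. U \<subseteq> points G \<and>
     (\<forall>e\<in>edges G. openin (top_of_set (edge_interval G e))
        {x \<in> edge_interval G e. graph_point G e x \<in> U}))"

lemma openin_graph_topology:
  "openin (graph_topology G) U \<longleftrightarrow> U \<subseteq> points G \<and>
     (\<forall>e\<in>edges G. openin (top_of_set (edge_interval G e))
        {x \<in> edge_interval G e. graph_point G e x \<in> U})"
proof -
  let ?pre = "\<lambda>e U. {x \<in> edge_interval G e. graph_point G e x \<in> U}"
  let ?P = "\<lambda>U. U \<subseteq> points G \<and>
     (\<forall>e\<in>edges G. openin (top_of_set (edge_interval G e)) (?pre e U))"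
  have "?P (S \<inter> T)" if S: "?P S" and T: "?P T" for S T
  proof (intro conjI ballI)
    show "S \<inter> T \<subseteq> points G" using S by blast
    fix e assume e: "e \<in> edges G"
    have eq: "?pre e (S \<inter> T) = ?pre e S \<inter> ?pre e T" by blast
    show "openin (top_of_set (edge_interval G e)) (?pre e (S \<inter> T))"
      unfolding eq by (rule openin_Int) (use S T e in blast)+
  qed
  moreover have "?P (\<Union>F)" if F: "\<forall>S\<in>F. ?P S" for F
  proof (intro conjI ballI)
    show "\<Union>F \<subseteq> points G" using F by blast
    fix e assume e: "e \<in> edges G"
    have eq: "?pre e (\<Union>F) = \<Union>(?pre e ` F)" by blast
    show "openin (top_of_set (edge_interval G e)) (?pre e (\<Union>F))"
      unfolding eq by (rule openin_Union) (use F e in blast)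
  qed
  ultimately have "istopology ?P"
    unfolding istopology_def by blast
  from topology_inverse'[OF this] show ?thesis
    by (simp only: graph_topology_def)
qed

lemma topspace_graph_topology: "topspace (graph_topology G) = points G"
proof
  show "topspace (graph_topology G) \<subseteq> points G"
    using openin_topspace[of "graph_topology G"] unfolding openin_graph_topology by blast
  have "{x \<in> edge_interval G e. graph_point G e x \<in> points G} = edge_interval G e"
    if "e \<in> edges G" for e
    using that by (auto simp: points_def)
  then have "openin (graph_topology G) (points G)"
    by (simp add: openin_graph_topology)
  then show "points G \<subseteq> topspace (graph_topology G)"
    by (rule openin_subset)
qed

definition connected_graph :: "('v, 'e) metric_graph \<Rightarrow> bool" where
  "connected_graph G \<longleftrightarrow> connected_space (graph_topology G)"

definition noncompact_graph :: "('v, 'e) metric_graph \<Rightarrow> bool" where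
  "noncompact_graph G \<longleftrightarrow> half_lines G \<noteq> {}"

definition local_maximum_point :: "'a topology \<Rightarrow> ('a \<Rightarrow> real) \<Rightarrow> 'a \<Rightarrow> bool" where
  "local_maximum_point X f a \<longleftrightarrow> (\<exists>U. openin X U \<and> a \<in> U \<and> (\<forall>y\<in>U. f y \<le> f a))"


section \<open>Sobolev spaces\<close>

definition L2 :: "real set \<Rightarrow> (real \<Rightarrow> real) set" where
  "L2 I = {f. f \<in> borel_measurable (lebesgue_on I) \<and> integrable (lebesgue_on I) (\<lambda>x. (f x)\<^sup>2)}"

definition test_functions :: "real set \<Rightarrow> (real \<Rightarrow> real) set" where
  "test_functions I = {\<phi>. \<phi> C1_differentiable_on UNIV \<and>
     compact (closure {x. \<phi> x \<noteq> 0}) \<and> closure {x. \<phi> x \<noteq> 0} \<subseteq> interior I}"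

definition L2_weak_derivative :: "real set \<Rightarrow> (real \<Rightarrow> real) \<Rightarrow> (real \<Rightarrow> real) \<Rightarrow> bool" where
  "L2_weak_derivative I f g \<longleftrightarrow> g \<in> L2 I \<and>
     (\<forall>\<phi>\<in>test_functions I.
        (\<integral>x. f x * deriv \<phi> x \<partial>lebesgue_on I) = - (\<integral>x. g x * \<phi> x \<partial>lebesgue_on I))"

definition H1_interval :: "real set \<Rightarrow> (real \<Rightarrow> real) set" where
  "H1_interval I = {f \<in> L2 I. \<exists>g. L2_weak_derivative I f g}"

text \<open>
  The weak derivative is unique up to null sets, so integrals do not depend on the
  representative chosen here.
\<close>

definition weak_deriv :: "real set \<Rightarrow> (real \<Rightarrow> real) \<Rightarrow> real \<Rightarrow> real" where
  "weak_deriv I f = (SOME g. L2_weak_derivative I f g)"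

definition on_edge :: "('v, 'e) metric_graph \<Rightarrow> (('v, 'e) graph_point \<Rightarrow> real) \<Rightarrow> 'e \<Rightarrow> real \<Rightarrow> real" where
  "on_edge G u e = (\<lambda>x. u (graph_point G e x))"

definition H1 :: "('v, 'e) metric_graph \<Rightarrow> (('v, 'e) graph_point \<Rightarrow> real) set" where
  "H1 G = {u. continuous_map (graph_topology G) euclideanreal u \<and>
     (\<forall>e\<in>edges G. on_edge G u e \<in> H1_interval (edge_interval G e))}"

definition H1_mass :: "('v, 'e) metric_graph \<Rightarrow> real \<Rightarrow> (('v, 'e) graph_point \<Rightarrow> real) set" where
  "H1_mass G \<mu> = {w \<in> H1 G.
     (\<Sum>e\<in>edges G. \<integral>x. \<bar>on_edge G w e x\<bar>\<^sup>2 \<partial>lebesgue_on (edge_interval G e)) = \<mu>}"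


section \<open>The energy, constrained critical points, Lagrange multipliers\<close>

definition energy :: "real \<Rightarrow> ('v, 'e) metric_graph \<Rightarrow> (('v, 'e) graph_point \<Rightarrow> real) \<Rightarrow> real" where
  "energy p G u =
     1/2 * (\<Sum>e\<in>edges G. \<integral>x. \<bar>weak_deriv (edge_interval G e) (on_edge G u e) x\<bar>\<^sup>2
                               \<partial>lebesgue_on (edge_interval G e))
     - 1/p * (\<Sum>e\<in>bounded_edges G. \<integral>x. \<bar>on_edge G u e x\<bar> powr p \<partial>lebesgue_on (edge_interval G e))"

text \<open>
  The tangent space at \<open>u\<close> of the constraint manifold consists of the \<open>v \<in> H1 G\<close> with
  \<open>\<integral> u v = 0\<close>. As the energy is continuously differentiable on \<open>H1 G\<close>, its differential at \<open>u\<close>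
  in direction \<open>v\<close> is the directional derivative.
\<close>

definition constrained_critical_point ::
    "real \<Rightarrow> ('v, 'e) metric_graph \<Rightarrow> real \<Rightarrow> (('v, 'e) graph_point \<Rightarrow> real) \<Rightarrow> bool" where
  "constrained_critical_point p G \<mu> u \<longleftrightarrow> u \<in> H1_mass G \<mu> \<and>
     (\<forall>v\<in>H1 G.
        (\<Sum>e\<in>edges G. \<integral>x. on_edge G u e x * on_edge G v e x \<partial>lebesgue_on (edge_interval G e)) = 0
        \<longrightarrow> ((\<lambda>t. energy p G (\<lambda>y. u y + t * v y)) has_real_derivative 0) (at 0))"

text \<open>
  \<open>u1 e\<close> and \<open>u2 e\<close> are the first and second derivative of \<open>u\<close> along \<open>e\<close>. The first derivative is
  required up to the endpoints (one-sided there), for the Kirchhoff condition; the differential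
  equation is required in the interior of the edge only, since the characteristic function
  of the compact core takes the value 1 at the vertex of a half-line when that vertex also
  belongs to a bounded edge. A loop contributes both its ends to the Kirchhoff sum.
\<close>

definition lagrange_multiplier ::
    "real \<Rightarrow> ('v, 'e) metric_graph \<Rightarrow> (('v, 'e) graph_point \<Rightarrow> real) \<Rightarrow> real \<Rightarrow> bool" where
  "lagrange_multiplier p G u lam \<longleftrightarrow> (\<exists>u1 u2.
     (\<forall>e\<in>edges G. \<forall>x\<in>edge_interval G e.
        (on_edge G u e has_real_derivative u1 e x) (at x within edge_interval G e)) \<and>
     (\<forall>e\<in>edges G. \<forall>x\<in>interior (edge_interval G e).
        (u1 e has_real_derivative u2 e x) (at x) \<and>
        - u2 e x + lam * on_edge G u e x =
          indicator (compact_core G) (graph_point G e x) *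
            \<bar>on_edge G u e x\<bar> powr (p - 2) * on_edge G u e x) \<and>
     (\<forall>v\<in>verts G.
        (\<Sum>e | e \<in> edges G \<and> src G e = v. u1 e 0) +
        (\<Sum>e | e \<in> bounded_edges G \<and> tgt G e = v. - u1 e (len G e)) = 0))"

end

theory Submission
  imports Defs "HOL-Real_Asymp.Real_Asymp"
begin

text \<open>
  On a half-line the nonlinearity vanishes, so \<open>u\<close> solves \<open>u'' = \<lambda> u\<close> there and is a combination
  of \<open>exp (\<plusminus> sqrt \<lambda> x)\<close>; square integrability kills the growing exponential. Hence \<open>u\<close> is
  strictly decreasing along half-lines and has no local maximum in their interiors. A vertex
  outside the compact core is incident to half-lines only, and these would form a connected
  component of the graph disjoint from the compact core.
\<close>

section \<open>Square-integrable solutions on the half-line\<close>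

text \<open>An integrable \<open>f\<close> would dominate \<open>c\<close> times the indicator of
  some ray, and so force that ray to have finite measure.\<close>

lemma not_integrable_eventually_ge:
  fixes f :: "real \<Rightarrow> real"
  assumes "c > 0" "eventually (\<lambda>x. f x \<ge> c) at_top"
  shows "\<not> integrable (lebesgue_on {a..}) f"
proof
  assume int: "integrable (lebesgue_on {a..}) f"
  obtain K0 where K0: "\<And>x. x \<ge> K0 \<Longrightarrow> f x \<ge> c"
    using assms(2) by (auto simp: eventually_at_top_linorder)
  \<comment> \<open>Taking the maximum with \<open>a\<close> keeps the ray inside the domain
    \<open>{a..}\<close>.\<close>
  define K where "K = max a K0"
  have sets: "{K..} \<in> sets (lebesgue_on {a..})"
    by (auto simp: sets_restrict_space_iff K_def)
  have "integrable (lebesgue_on {a..}) (\<lambda>x. c * indicator {K..} x)"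
  proof (rule Bochner_Integration.integrable_bound[OF int])
    show "(\<lambda>x. c * indicator {K..} x) \<in> borel_measurable (lebesgue_on {a..})"
      using sets by measurable
    have "norm (c * indicator {K..} x) \<le> norm (f x)" for x
      using K0[of x] assms(1) by (auto simp: indicator_def K_def)
    then show "AE x in lebesgue_on {a..}. norm (c * indicator {K..} x) \<le> norm (f x)"
      by simp
  qed
  then have "integrable (lebesgue_on {a..}) (indicator {K..} :: real \<Rightarrow> real)"
    using assms(1) by simp
  then have "emeasure (lebesgue_on {a..}) {K..} < \<infinity>"
    using sets by (simp add: integrable_indicator_iff Int_absorb2 K_def)
  moreover have "emeasure (lebesgue_on {a..}) {K..} = emeasure lborel {K..}"
    by (subst emeasure_restrict_space) (auto simp: K_def)
  \<comment> \<open>The ray contains the interval from \<open>K\<close> to \<open>K + n\<close>, so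
    its measure exceeds every natural number.\<close>
  moreover have "emeasure lborel {K..} \<ge> ennreal (real n)" for n
    using emeasure_mono[of "{K..K + real n}" "{K..}" lborel] by auto
  moreover obtain n where "emeasure lborel {K..} < of_nat n"
    using calculation ennreal_Ex_less_of_nat[of "emeasure lborel {K..}"] by auto
  ultimately show False
    by (metis ennreal_of_nat_eq_real_of_nat not_le)
qed

text \<open>The operator \<open>D^2 - s^2\<close> factors as \<open>(D - s)(D + s)\<close>, which
  yields two first integrals. They express \<open>f\<close> as a combination of a growing and a
  decaying exponential, and square integrability excludes the growing one.\<close>

lemma positive_L2_solution_exponential:
  fixes f f' :: "real \<Rightarrow> real"
  assumes s: "s > 0"
    and f: "\<And>x. x \<ge> 0 \<Longrightarrow> (f has_real_derivative f' x) (at x within {0..})"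
    and f': "\<And>x. x > 0 \<Longrightarrow> (f' has_real_derivative s\<^sup>2 * f x) (at x)"
    and pos: "\<And>x. x \<ge> 0 \<Longrightarrow> f x > 0"
    and L2: "integrable (lebesgue_on {0..}) (\<lambda>x. (f x)\<^sup>2)"
    and x: "x \<ge> 0"
  shows "f x = f 0 * exp (- s * x)"
proof -
  have fi: "(f has_real_derivative f' x) (at x)" if "x > 0" for x
    using f[of x] that at_within_interior[of x "{0..}"] by simp
  \<comment> \<open>First integral: \<open>f' + s f\<close> solves \<open>g' = s g\<close>. The
    second-order equation is known only for positive \<open>x\<close>, hence the open
    half-line.\<close>
  have "\<exists>A. \<forall>x\<in>{0<..}. (f' x + s * f x) * exp (- s * x) = A"
    using s by (intro has_field_derivative_zero_constant)
      (auto intro!: derivative_eq_intros DERIV_subset[OF fi] DERIV_subset[OF f']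
        simp: algebra_simps power2_eq_square)
  then obtain A where A: "\<And>x. x > 0 \<Longrightarrow> (f' x + s * f x) * exp (- s * x) = A" by auto
  have "\<exists>B. \<forall>x\<in>{0<..}. (f' x - s * f x) * exp (s * x) = B"
    using s by (intro has_field_derivative_zero_constant)
      (auto intro!: derivative_eq_intros DERIV_subset[OF fi] DERIV_subset[OF f']
        simp: algebra_simps power2_eq_square)
  then obtain B where B: "\<And>x. x > 0 \<Longrightarrow> (f' x - s * f x) * exp (s * x) = B" by auto
  have f_eq: "f x = (A * exp (s * x) - B * exp (- s * x)) / (2 * s)" if "x > 0" for x
  proof -
    have "f' x + s * f x = A * exp (s * x)" "f' x - s * f x = B * exp (- s * x)"
      using A[OF that] B[OF that] by (auto simp: exp_minus field_simps)
    then show ?thesis using s by (simp add: field_simps)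
  qed
  have "A = 0"
  proof (rule ccontr)
    assume "A \<noteq> 0"
    then have "eventually (\<lambda>x. ((A * exp (s * x) - B * exp (- s * x)) / (2 * s))\<^sup>2 \<ge> 1) at_top"
      \<comment> \<open>The square tends to infinity whatever the sign of \<open>A\<close>; the
        cases fix the sign of the leading coefficient and whether the decaying term is
        present.\<close>
      using s by (cases "A > 0"; cases "B = 0") real_asymp+
    then have "eventually (\<lambda>x. (f x)\<^sup>2 \<ge> 1) at_top"
      using eventually_gt_at_top[of 0] by eventually_elim (simp add: f_eq)
    then show False
      using not_integrable_eventually_ge[of 1] L2 by auto
  qed
  have f'_eq: "f' x = - s * f x" if "x > 0" for x
    using A[OF that] \<open>A = 0\<close> by simp
  show ?thesis
  proof (cases "x = 0")
    case False
    \<comment> \<open>With \<open>A = 0\<close> the equation drops to \<open>f' = - s f\<close>, so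
      this product has zero derivative for positive arguments; continuity carries the constant down
      to the endpoint 0.\<close>
    have "f x * exp (s * x) = f 0 * exp (s * 0)"
    proof (rule DERIV_isconst_end[where f = "\<lambda>x. f x * exp (s * x)"])
      have "continuous_on {0..} f"
        by (rule DERIV_continuous_on[where D = f']) (simp add: f)
      then have "continuous_on {0..x} f"
        by (rule continuous_on_subset) auto
      then show "continuous_on {0..x} (\<lambda>x. f x * exp (s * x))"
        by (intro continuous_intros)
      show "((\<lambda>x. f x * exp (s * x)) has_real_derivative 0) (at y)" if "0 < y" "y < x" for y
        using that by (auto intro!: derivative_eq_intros fi simp: f'_eq)
    qed (use x False in simp)
    then show ?thesis by (simp add: exp_minus field_simps)
  qed simp
qed

section \<open>Half-lines of a metric graph\<close>

context finite_metric_graph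
begin

lemma half_line_not_bounded: "e \<in> half_lines G \<Longrightarrow> e \<notin> bounded_edges G"
  using bounded_edges_half_lines_disjoint by blast

lemma edge_interval_half_line: "e \<in> half_lines G \<Longrightarrow> edge_interval G e = {0..}"
  by (simp add: edge_interval_def half_line_not_bounded)

lemma graph_point_half_line:
  "e \<in> half_lines G \<Longrightarrow> graph_point G e x = (if x = 0 then Vertex (src G e) else Inner e x)"
  by (simp add: graph_point_def half_line_not_bounded)

lemma Inner_half_line_notin_compact_core:
  "e \<in> half_lines G \<Longrightarrow> Inner e x \<notin> compact_core G"
  by (auto simp: compact_core_def graph_point_def half_line_not_bounded split: if_splits)

lemma Vertex_src_in_compact_core:
  assumes "e \<in> bounded_edges G"
  shows "Vertex (src G e) \<in> compact_core G"
proof -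
  have "Vertex (src G e) = graph_point G e 0" "0 \<in> edge_interval G e"
    using assms len_pos[OF assms] by (auto simp: graph_point_def edge_interval_def)
  then show ?thesis using assms by (auto simp: compact_core_def)
qed

lemma Vertex_tgt_in_compact_core:
  assumes "e \<in> bounded_edges G"
  shows "Vertex (tgt G e) \<in> compact_core G"
proof -
  have "Vertex (tgt G e) = graph_point G e (len G e)" "len G e \<in> edge_interval G e"
    using assms len_pos[OF assms] by (auto simp: graph_point_def edge_interval_def)
  then show ?thesis using assms by (auto simp: compact_core_def)
qed

text \<open>Otherwise \<open>v\<close> together with the half-lines issuing from it would be a
  nonempty open and closed set missing the nonempty core, against connectedness.\<close>

lemma Vertex_in_compact_core:
  assumes "connected_graph G" "compact_core G \<noteq> {}" "v \<in> verts G"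
  shows "Vertex v \<in> compact_core G"
proof (rule ccontr)
  assume nv: "Vertex v \<notin> compact_core G"
  define S where "S = insert (Vertex v) {Inner e x | e x. e \<in> half_lines G \<and> src G e = v \<and> x > 0}"
  have nS: "\<not> (e \<in> bounded_edges G \<and> (src G e = v \<or> tgt G e = v))" for e
    using Vertex_src_in_compact_core Vertex_tgt_in_compact_core nv by blast
  \<comment> \<open>The right-hand side does not depend on \<open>x\<close>: each edge lies wholly
    inside or wholly outside \<open>S\<close>. This gives openness of both \<open>S\<close> and its
    complement.\<close>
  have pre: "graph_point G e x \<in> S \<longleftrightarrow> e \<in> half_lines G \<and> src G e = v"
    if "e \<in> edges G" "x \<in> edge_interval G e" for e x
    using that nS[of e] half_line_not_bounded[of e]
    by (auto simp: S_def graph_point_def edge_interval_def edges_def split: if_splits)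
  have "S \<subseteq> points G"
  proof
    fix y assume "y \<in> S"
    then consider "y = Vertex v" | e x where "y = Inner e x" "e \<in> half_lines G" "x > 0"
      by (auto simp: S_def)
    then show "y \<in> points G"
    proof cases
      case 2
      then have "y = graph_point G e x" "x \<in> edge_interval G e" "e \<in> edges G"
        by (auto simp: graph_point_half_line edge_interval_half_line edges_def)
      then show ?thesis by (auto simp: points_def)
    qed (use assms(3) in \<open>auto simp: points_def\<close>)
  qed
  have S: "openin (graph_topology G) S"
    unfolding openin_graph_topology
  proof (intro conjI ballI \<open>S \<subseteq> points G\<close>)
    fix e assume e: "e \<in> edges G"
    have "{x \<in> edge_interval G e. graph_point G e x \<in> S} =
        (if e \<in> half_lines G \<and> src G e = v then edge_interval G e else {})"
      using pre[OF e] by auto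
    then show "openin (top_of_set (edge_interval G e))
        {x \<in> edge_interval G e. graph_point G e x \<in> S}" by auto
  qed
  have C: "openin (graph_topology G) (points G - S)"
    unfolding openin_graph_topology
  proof (intro conjI ballI)
    fix e assume e: "e \<in> edges G"
    have "graph_point G e x \<in> points G" if "x \<in> edge_interval G e" for x
      using that e by (auto simp: points_def)
    then have "{x \<in> edge_interval G e. graph_point G e x \<in> points G - S} =
        (if e \<in> half_lines G \<and> src G e = v then {} else edge_interval G e)"
      using pre[OF e] by auto
    then show "openin (top_of_set (edge_interval G e))
        {x \<in> edge_interval G e. graph_point G e x \<in> points G - S}" by auto
  qed auto
  have "S \<inter> compact_core G = {}"
    using nv by (auto simp: S_def Inner_half_line_notin_compact_core)
  moreover have "compact_core G \<subseteq> points G"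
    by (auto simp: compact_core_def points_def edges_def)
  ultimately have "points G - S \<noteq> {}"
    using assms(2) by blast
  moreover have "S \<noteq> {}" by (simp add: S_def)
  ultimately show False
    using assms(1) S C \<open>S \<subseteq> points G\<close>
    unfolding connected_graph_def connected_space_def topspace_graph_topology
    by blast
qed

text \<open>Every neighbourhood of an inner point contains points of the same half-line slightly
  nearer to its vertex, where \<open>u\<close> is larger.\<close>

lemma not_local_maximum_Inner_half_line:
  assumes e: "e \<in> half_lines G" and x: "x > 0"
    and decr: "\<And>y. 0 \<le> y \<Longrightarrow> y < x \<Longrightarrow> u (graph_point G e y) > u (graph_point G e x)"
  shows "\<not> local_maximum_point (graph_topology G) u (Inner e x)"
proof
  assume "local_maximum_point (graph_topology G) u (Inner e x)"
  then obtain U where U: "openin (graph_topology G) U" "Inner e x \<in> U"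
      "\<And>y. y \<in> U \<Longrightarrow> u y \<le> u (Inner e x)"
    by (auto simp: local_maximum_point_def)
  have gx: "graph_point G e x = Inner e x"
    using x by (simp add: graph_point_half_line[OF e])
  have op: "openin (top_of_set {0..}) {y \<in> {0..}. graph_point G e y \<in> U}"
  proof -
    have "e \<in> edges G" using e by (simp add: edges_def)
    then have "openin (top_of_set (edge_interval G e)) {y \<in> edge_interval G e. graph_point G e y \<in> U}"
      using U(1) unfolding openin_graph_topology by blast
    then show ?thesis by (simp only: edge_interval_half_line[OF e])
  qed
  then obtain d where d: "d > 0" "\<And>y. y \<ge> 0 \<Longrightarrow> dist y x < d \<Longrightarrow> graph_point G e y \<in> U"
  proof -
    have "x \<in> {y \<in> {0..}. graph_point G e y \<in> U}" using U(2) x gx by simp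
    then show ?thesis
      using op that unfolding openin_euclidean_subtopology_iff by (metis (no_types, lifting) atLeast_iff mem_Collect_eq)
  qed
  \<comment> \<open>A point to the left of \<open>x\<close> at distance at most
    \<open>d / 2\<close>; the maximum keeps it on the half-line.\<close>
  define y where "y = max 0 (x - d / 2)"
  have y: "0 \<le> y" "y < x" "dist y x < d"
    using d(1) x by (auto simp: y_def dist_real_def)
  show False
    using decr[OF y(1,2)] U(3)[OF d(2)[OF y(1,3)]] by (simp add: gx)
qed

lemma positive_solution_on_half_line:
  assumes e: "e \<in> half_lines G"
    and H1: "u \<in> H1 G"
    and lag: "lagrange_multiplier p G u lam"
    and pos: "\<forall>x\<in>points G. u x > 0"
    and lam: "lam > 0"
  shows "\<exists>c>0. \<forall>x\<ge>0. u (graph_point G e x) = c * exp (- sqrt lam * x)"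
proof -
  have ee: "e \<in> edges G" using e by (simp add: edges_def)
  note I = edge_interval_half_line[OF e]
  obtain u1 u2 where u1: "\<And>x. x \<ge> 0 \<Longrightarrow>
        (on_edge G u e has_real_derivative u1 e x) (at x within {0..})"
    and u2: "\<And>x. x > 0 \<Longrightarrow> (u1 e has_real_derivative u2 e x) (at x)"
    and eq: "\<And>x. x > 0 \<Longrightarrow> - u2 e x + lam * on_edge G u e x =
          indicator (compact_core G) (graph_point G e x) *
            \<bar>on_edge G u e x\<bar> powr (p - 2) * on_edge G u e x"
    using lag ee unfolding lagrange_multiplier_def by (fastforce simp: I)
  \<comment> \<open>For positive \<open>x\<close> the point is inner to a half-line, so the
    indicator of the core vanishes and the equation becomes linear, with
    \<open>s = sqrt lam\<close>.\<close>
  have u2_eq: "u2 e x = (sqrt lam)\<^sup>2 * on_edge G u e x" if "x > 0" for x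
    using eq[OF that] that lam
    by (simp add: graph_point_half_line[OF e] Inner_half_line_notin_compact_core[OF e])
  have pos': "on_edge G u e x > 0" if "x \<ge> 0" for x
  proof -
    have "graph_point G e x \<in> points G" using that ee unfolding points_def I[symmetric]
      by (intro UnI2 UN_I[of e] imageI) (auto simp: I)
    then show ?thesis using pos by (simp add: on_edge_def)
  qed
  have u1': "(u1 e has_real_derivative (sqrt lam)\<^sup>2 * on_edge G u e x) (at x)" if "x > 0" for x
    using u2[OF that] by (simp only: u2_eq[OF that])
  have L2: "integrable (lebesgue_on {0..}) (\<lambda>x. (on_edge G u e x)\<^sup>2)"
  proof -
    have "on_edge G u e \<in> H1_interval (edge_interval G e)"
      using H1 ee by (simp add: H1_def)
    then show ?thesis
      by (simp add: H1_interval_def L2_def I)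
  qed
  have "sqrt lam > 0" using lam by simp
  from positive_L2_solution_exponential[of _ "on_edge G u e" "u1 e", OF this u1 u1' pos' L2]
  have "\<forall>x\<ge>0. on_edge G u e x = on_edge G u e 0 * exp (- sqrt lam * x)"
    by blast
  then show ?thesis
    using pos'[of 0] unfolding on_edge_def by blast
qed

end

theorem proposition1p4:
  fixes G :: "('v, 'e) metric_graph"
    and p \<mu> lam :: real
    and u :: "('v, 'e) graph_point \<Rightarrow> real"
  assumes "finite_metric_graph G"
    and "connected_graph G"
    and "noncompact_graph G"
    and "compact_core G \<noteq> {}"
    and "p > 6"
    and "\<mu> > 0"
    and "constrained_critical_point p G \<mu> u"
    and "lagrange_multiplier p G u lam"
    and "\<forall>x\<in>points G. u x > 0"
    and "lam > 0"
  shows "(\<forall>xbar\<in>points G. local_maximum_point (graph_topology G) u xbar \<longrightarrow> xbar \<in> compact_core G) \<and>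
         (\<forall>e\<in>half_lines G. \<exists>c>0. \<forall>x\<ge>0. u (graph_point G e x) = c * exp (- sqrt lam * x))"
proof -
  interpret finite_metric_graph G by fact
  have "u \<in> H1 G"
    using assms(7) by (simp add: constrained_critical_point_def H1_mass_def)
  then have exp: "\<exists>c>0. \<forall>x\<ge>0. u (graph_point G e x) = c * exp (- sqrt lam * x)"
    if "e \<in> half_lines G" for e
    using positive_solution_on_half_line[OF that] assms(8-10) by blast
  have "xbar \<in> compact_core G"
    if xbar: "xbar \<in> points G" "local_maximum_point (graph_topology G) u xbar" for xbar
  proof (rule ccontr)
    assume nc: "xbar \<notin> compact_core G"
    \<comment> \<open>All vertices lie in the core, and so do all bounded edges; what remains for
      \<open>xbar\<close> is the interior of a half-line, where \<open>u\<close> is strictly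
      decreasing.\<close>
    then have "xbar \<noteq> Vertex v" if "v \<in> verts G" for v
      using Vertex_in_compact_core[OF assms(2,4) that] by blast
    moreover from this obtain e x
      where ex: "e \<in> edges G" "x \<in> edge_interval G e" "xbar = graph_point G e x"
      using xbar(1) by (auto simp: points_def)
    moreover from ex nc have e: "e \<in> half_lines G"
      by (auto simp: edges_def compact_core_def)
    ultimately have x: "x > 0" "xbar = Inner e x"
      using src_in_verts[of e]
      by (auto simp: edge_interval_half_line graph_point_half_line split: if_splits)
    obtain c where c: "c > 0" "\<And>x. x \<ge> 0 \<Longrightarrow> u (graph_point G e x) = c * exp (- sqrt lam * x)"
      using exp[OF e] by blast
    have "u (graph_point G e y) > u (graph_point G e x)" if "0 \<le> y" "y < x" for y
      using that c x assms(10) by simp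
    then show False
      using not_local_maximum_Inner_half_line[OF e x(1)] xbar(2) x(2) by blast
  qed
  then show ?thesis using exp by blast
qed

end
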